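(* Let $\mathbb{F}$ be a field of characteristic $p>0$. There is an algorithm which takes as input a nonzero polynomial $f(X)\in\mathbb{F}_p(t)[X]$ and outputs a natural number $m$ not divisible by $p$ such that any root of $f$ in $\mathbb{F}((t^{\mathbb{Q}}))$ is already in $\mathbb{F}((t^{\Gamma_m}))$.
   Context: For an ordered abelian group $\Gamma$, $\mathbb{F}((t^\Gamma))$ denotes the Hahn field of generalised power series $\sum_{\gamma}a_\gamma t^\gamma$ with $a_\gamma\in\mathbb{F}$ and well-ordered support $\{\gamma\in\Gamma\mid a_\gamma\ne0\}$; $\mathbb{F}_p(t)$ is viewed as a subfield in the natural way. For a positive integer $m$, $\Gamma_m:=\frac{1}{mp^\infty}\mathbb{Z}=\{\frac{a}{mp^k}\mid a\in\mathbb{Z},\ k\in\mathbb{N}\}\subseteq\mathbb{Q}$, so $\mathbb{F}((t^{\Gamma_m}))\subseteq\mathbb{F}((t^{\mathbb{Q}}))$. *)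

theory Defs
  imports
    "HOL-Library.Nat_Bijection"
    "HOL-Computational_Algebra.Computational_Algebra"
    "Berlekamp_Zassenhaus.Finite_Field"
begin

section \<open>Well-ordered subsets of ordered abelian groups\<close>

lemma wo_iff_no_descent:
  fixes A :: "'g::linorder set"
  shows "wfp_on A (<) \<longleftrightarrow> \<not> (\<exists>c::nat \<Rightarrow> 'g. \<forall>n. c n \<in> A \<and> c (Suc n) < c n)"
proof -
  have "wfp_on A (<) \<longleftrightarrow> wfp (\<lambda>x y. x < y \<and> x \<in> A \<and> y \<in> A)"
    by (rule wfp_on_iff_wfp)
  also have "\<dots> \<longleftrightarrow> \<not> (\<exists>c::nat \<Rightarrow> 'g. \<forall>n. c (Suc n) < c n \<and> c (Suc n) \<in> A \<and> c n \<in> A)"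
    unfolding wfp_def wf_iff_no_infinite_down_chain by simp
  finally show ?thesis by blast
qed

lemma wo_no_descent:
  fixes c :: "nat \<Rightarrow> 'g::linorder"
  assumes "wfp_on A (<)" "\<And>n. c n \<in> A" "\<And>n. c (Suc n) < c n"
  shows False
  using assms unfolding wo_iff_no_descent by blast

lemma descent_less:
  fixes c :: "nat \<Rightarrow> 'g::linorder"
  assumes "\<And>n. c (Suc n) < c n" "i < j"
  shows "c j < c i"
  using assms(2) by (induction rule: less_Suc_induct) (use assms(1) in auto)

lemma wo_seq_mono:
  fixes s :: "nat \<Rightarrow> 'g::linorder"
  assumes "wfp_on A (<)" and "\<And>n. s n \<in> A"
  obtains f :: "nat \<Rightarrow> nat" where "strict_mono f" "\<And>m n. m \<le> n \<Longrightarrow> s (f m) \<le> s (f n)"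
proof -
  define P where "P = (\<lambda>i j. i < j \<and> (\<forall>k\<ge>j. s j \<le> s k))"
  have ex: "\<exists>j>i. \<forall>k\<ge>j. s j \<le> s k" for i
  proof -
    have "s ` {i<..} \<subseteq> A" "s ` {i<..} \<noteq> {}" using assms(2) by auto
    then obtain z where z: "z \<in> s ` {i<..}" "\<forall>y. y < z \<longrightarrow> y \<notin> s ` {i<..}"
      using assms(1) unfolding wfp_on_iff_ex_minimal by meson
    then obtain j where "j > i" "z = s j" by auto
    with z(2) show ?thesis
      by (intro exI[of _ j]) (force simp: not_less[symmetric])
  qed
  have "\<exists>f. \<forall>n. (\<forall>k\<ge>f n. s (f n) \<le> s k) \<and> f n < f (Suc n)"
  proof (rule dependent_nat_choice)
    show "\<exists>x. \<forall>k\<ge>x. s x \<le> s k" using ex[of 0] by blast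
    show "\<exists>y. (\<forall>k\<ge>y. s y \<le> s k) \<and> x < y" for x using ex[of x] by blast
  qed
  then obtain f :: "nat \<Rightarrow> nat" where f: "\<And>n k. k \<ge> f n \<Longrightarrow> s (f n) \<le> s k" "\<And>n. f n < f (Suc n)"
    by blast
  have sm: "strict_mono f" using f(2) by (simp add: strict_mono_Suc_iff)
  then show thesis
    using that f(1) by (meson strict_mono_less_eq)
qed

lemma wo_Un:
  fixes A B :: "'g::linorder set"
  assumes "wfp_on A (<)" "wfp_on B (<)"
  shows "wfp_on (A \<union> B) (<)"
  unfolding wfp_on_iff_ex_minimal
proof (intro allI impI)
  fix C assume C: "C \<subseteq> A \<union> B" "C \<noteq> {}"
  show "\<exists>z\<in>C. \<forall>y. y < z \<longrightarrow> y \<notin> C"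
  proof (cases "C \<inter> A = {} \<or> C \<inter> B = {}")
    case True
    then have "C \<subseteq> A \<or> C \<subseteq> B" using C by blast
    then show ?thesis using assms C(2) unfolding wfp_on_iff_ex_minimal by blast
  next
    case False
    obtain a where a: "a \<in> C \<inter> A" "\<forall>y. y < a \<longrightarrow> y \<notin> C \<inter> A"
      using assms(1) False unfolding wfp_on_iff_ex_minimal by (meson inf_le2)
    obtain b where b: "b \<in> C \<inter> B" "\<forall>y. y < b \<longrightarrow> y \<notin> C \<inter> B"
      using assms(2) False unfolding wfp_on_iff_ex_minimal by (meson inf_le2)
    have "\<forall>y. y < min a b \<longrightarrow> y \<notin> C" using a b C(1) by auto
    moreover have "min a b \<in> C" using a b by (auto simp: min_def)
    ultimately show ?thesis by blast
  qed
qed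

lemma wo_sumset:
  fixes A B :: "'g::linordered_ab_group_add set"
  assumes "wfp_on A (<)" "wfp_on B (<)"
  shows "wfp_on {a + b | a b. a \<in> A \<and> b \<in> B} (<)"
  unfolding wo_iff_no_descent
proof
  assume "\<exists>c::nat \<Rightarrow> 'g. \<forall>n. c n \<in> {a + b | a b. a \<in> A \<and> b \<in> B} \<and> c (Suc n) < c n"
  then obtain c where c: "\<And>n. \<exists>a b. c n = a + b \<and> a \<in> A \<and> b \<in> B" "\<And>n. c (Suc n) < c n"
    by blast
  from c(1) obtain a b where ab: "\<And>n. c n = a n + b n" "\<And>n. a n \<in> A" "\<And>n. b n \<in> B"
    by metis
  obtain f :: "nat \<Rightarrow> nat" where f: "strict_mono f" "\<And>m n. m \<le> n \<Longrightarrow> a (f m) \<le> a (f n)"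
    using wo_seq_mono[of A a] assms(1) ab(2) by blast
  have "b (f (Suc n)) < b (f n)" for n
  proof -
    have "c (f (Suc n)) < c (f n)"
      by (rule descent_less[of c, OF c(2)]) (use f(1) in \<open>simp add: strict_mono_less\<close>)
    moreover have "a (f n) \<le> a (f (Suc n))" using f(2) by simp
    ultimately show ?thesis unfolding ab(1)
      by (meson add_mono not_le)
  qed
  then show False using wo_no_descent[of B "\<lambda>n. b (f n)"] assms(2) ab(3) by blast
qed

definition decomps :: "'g::linordered_ab_group_add set \<Rightarrow> 'g set \<Rightarrow> 'g \<Rightarrow> ('g \<times> 'g) set" where
  "decomps A B g = {(h, k). h \<in> A \<and> k \<in> B \<and> h + k = g}"

lemma finite_decomps:
  assumes "wfp_on A (<)" "wfp_on B (<)"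
  shows "finite (decomps A B g)"
proof (rule ccontr)
  assume inf: "infinite (decomps A B g)"
  have eq: "decomps A B g = (\<lambda>h. (h, g - h)) ` {h \<in> A. g - h \<in> B}"
    by (auto simp: decomps_def algebra_simps image_iff)
  have "infinite {h \<in> A. g - h \<in> B}" using inf unfolding eq by auto
  then obtain s :: "nat \<Rightarrow> 'a" where s: "inj s" "range s \<subseteq> {h \<in> A. g - h \<in> B}"
    using infinite_countable_subset by blast
  obtain f :: "nat \<Rightarrow> nat" where f: "strict_mono f" "\<And>m n. m \<le> n \<Longrightarrow> s (f m) \<le> s (f n)"
    using wo_seq_mono[of A s] assms(1) s(2) by blast
  have "s (f n) < s (f (Suc n))" for n
  proof -
    have "s (f n) \<noteq> s (f (Suc n))"
      using s(1) f(1) by (metis injD lessI less_irrefl strict_mono_less)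
    then show ?thesis using f(2)[of n "Suc n"] by simp
  qed
  then have "g - s (f (Suc n)) < g - s (f n)" for n by simp
  moreover have "g - s (f n) \<in> B" for n using s(2) by auto
  ultimately show False using wo_no_descent[of B "\<lambda>n. g - s (f n)"] assms(2) by blast
qed

text \<open>Neumann's lemma: the submonoid generated by a well-ordered set of positive elements is
  well-ordered.\<close>

lemma wo_monoid_gen:
  fixes S :: "'g::linordered_ab_group_add set"
  assumes wo: "wfp_on S (<)" and pos: "\<And>s. s \<in> S \<Longrightarrow> 0 < s"
  shows "wfp_on (sum_list ` lists S) (<)"
proof (rule ccontr)
  define M where "M = sum_list ` lists S"
  define bad where "bad g \<longleftrightarrow> (\<exists>c::nat \<Rightarrow> 'g. c 0 = g \<and> (\<forall>n. c n \<in> M \<and> c (Suc n) < c n))" for g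
  define len where "len g = (LEAST n. \<exists>w\<in>lists S. sum_list w = g \<and> length w = n)" for g :: 'g
  have nonneg: "0 \<le> g" if "g \<in> M" for g
  proof -
    from that obtain w where "w \<in> lists S" "g = sum_list w" unfolding M_def by blast
    then show ?thesis using pos by (auto intro!: sum_list_nonneg simp: in_lists_conv_set less_imp_le)
  qed
  have bad_M: "g \<in> M" if "bad g" for g using that unfolding bad_def by blast
  have bad_less: "\<exists>h<g. bad h" if "bad g" for g
  proof -
    from that obtain c where c: "c 0 = g" "\<And>n. c n \<in> M" "\<And>n. c (Suc n) < c n"
      unfolding bad_def by blast
    have "bad (c (Suc 0))" unfolding bad_def
      by (rule exI[of _ "\<lambda>n. c (Suc n)"]) (use c in auto)
    then show ?thesis using c(1,3) by metis
  qed
  have split: "\<exists>s\<in>S. \<exists>h\<in>M. g = s + h \<and> len h < len g" if "bad g" for g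
  proof -
    have "\<exists>w\<in>lists S. sum_list w = g" using bad_M[OF that] unfolding M_def by auto
    then have "\<exists>n. \<exists>w\<in>lists S. sum_list w = g \<and> length w = n" by blast
    from LeastI_ex[OF this] obtain w
      where w: "w \<in> lists S" "sum_list w = g" "length w = len g"
      unfolding len_def[symmetric] by blast
    have "g \<noteq> 0" using bad_less[OF that] bad_M nonneg by (metis not_le)
    then obtain s v where sv: "w = s # v" using w(2) by (cases w) auto
    have "len (sum_list v) \<le> length v" unfolding len_def
      using w(1) sv by (intro Least_le) auto
    then show ?thesis using w sv unfolding M_def by (intro bexI[of _ s] bexI[of _ "sum_list v"]) auto
  qed
  assume "\<not> wfp_on (sum_list ` lists S) (<)"
  then have "\<exists>g. bad g" unfolding wo_iff_no_descent M_def[symmetric] bad_def by blast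
  then obtain b0 where b0: "bad b0" "\<And>h. bad h \<Longrightarrow> len b0 \<le> len h"
    using ex_has_least_nat[of bad _ len] by blast
  have step: "\<exists>h. (bad h \<and> h < g \<and> (\<forall>h'. bad h' \<and> h' < g \<longrightarrow> len h \<le> len h'))"
    if "bad g" for g
    using bad_less[OF that] ex_has_least_nat[of "\<lambda>h. bad h \<and> h < g" _ len] by blast
  have "\<exists>b. \<forall>n::nat. (bad (b n) \<and> (n = 0 \<longrightarrow> b n = b0)) \<and>
      (b (Suc n) < b n \<and> (\<forall>h'. bad h' \<and> h' < b n \<longrightarrow> len (b (Suc n)) \<le> len h'))"
    using b0(1) step by (intro dependent_nat_choice) auto
  then obtain b where b: "\<And>n::nat. bad (b n)" "b 0 = b0" "\<And>n. b (Suc n) < b n"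
    "\<And>n h. bad h \<Longrightarrow> h < b n \<Longrightarrow> len (b (Suc n)) \<le> len h"
    by metis
  from split[OF b(1)] obtain s t where st: "\<And>n. s n \<in> S" "\<And>n. t n \<in> M"
    "\<And>n. b n = s n + t n" "\<And>n. len (t n) < len (b n)"
    by metis
  obtain f :: "nat \<Rightarrow> nat" where f: "strict_mono f" "\<And>m n. m \<le> n \<Longrightarrow> s (f m) \<le> s (f n)"
    using wo_seq_mono[of S s] wo st(1) by blast
  have "t (f (Suc n)) < t (f n)" for n
  proof -
    have "b (f (Suc n)) < b (f n)"
      by (rule descent_less[of b, OF b(3)]) (use f(1) in \<open>simp add: strict_mono_less\<close>)
    moreover have "s (f n) \<le> s (f (Suc n))" using f(2) by simp
    ultimately show ?thesis unfolding st(3)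
      by (meson add_mono not_le)
  qed
  then have bt: "bad (t (f 0))" unfolding bad_def
    by (intro exI[of _ "\<lambda>n. t (f n)"]) (use st(2) in auto)
  have lt: "t (f 0) < b (f 0)" using st(3)[of "f 0"] pos[OF st(1)[of "f 0"]] by simp
  show False
  proof (cases "f 0")
    case 0
    then show False using b0(2)[OF bt] st(4)[of "f 0"] b(2) by simp
  next
    case (Suc n)
    then have "t (f 0) < b n" using lt b(3)[of n] by simp
    then show False using b(4)[OF bt] st(4)[of "f 0"] Suc by (metis not_le)
  qed
qed


section \<open>Hahn series\<close>

typedef (overloaded) ('a::zero, 'g::linorder) hahn =
  "{f :: 'g \<Rightarrow> 'a. wfp_on {g. f g \<noteq> 0} (<)}"
  morphisms hcoeff Abs_hahn
  by (rule exI[of _ "\<lambda>_. 0"]) (simp add: wfp_on_def)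

setup_lifting type_definition_hahn

definition supp :: "('a::zero, 'g::linorder) hahn \<Rightarrow> 'g set" where
  "supp x = {g. hcoeff x g \<noteq> 0}"

lemma wo_supp: "wfp_on (supp x) (<)"
  using hcoeff[of x] by (simp add: supp_def)

lemma hcoeff_eq_0: "g \<notin> supp x \<Longrightarrow> hcoeff x g = 0"
  by (simp add: supp_def)

lemma hahn_eqI: "(\<And>g. hcoeff x g = hcoeff y g) \<Longrightarrow> x = y"
  by (simp add: hcoeff_inject[symmetric] fun_eq_iff)

text \<open>The monomial \<open>a t\<^sup>g\<close>.\<close>

lift_definition hmonom :: "'a::zero \<Rightarrow> 'g::linorder \<Rightarrow> ('a, 'g) hahn" is
  "\<lambda>a g h. if h = g then a else 0"
  by (rule wfp_on_subset[where B = "{_}"]) (auto simp: wfp_on_def)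

instantiation hahn :: (zero, linorder) zero
begin
lift_definition zero_hahn :: "('a, 'b) hahn" is "\<lambda>_. 0" by (simp add: wfp_on_def)
instance ..
end

instantiation hahn :: (ab_group_add, linorder) ab_group_add
begin
lift_definition plus_hahn :: "('a, 'b) hahn \<Rightarrow> ('a, 'b) hahn \<Rightarrow> ('a, 'b) hahn" is
  "\<lambda>x y g. x g + y g"
  by (rule wfp_on_subset, erule (1) wo_Un) auto
lift_definition uminus_hahn :: "('a, 'b) hahn \<Rightarrow> ('a, 'b) hahn" is "\<lambda>x g. - x g" by simp
lift_definition minus_hahn :: "('a, 'b) hahn \<Rightarrow> ('a, 'b) hahn \<Rightarrow> ('a, 'b) hahn" is
  "\<lambda>x y g. x g - y g"
  by (rule wfp_on_subset, erule (1) wo_Un) auto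
instance by standard (transfer; simp add: fun_eq_iff)+
end

instantiation hahn :: (comm_ring_1, linordered_ab_group_add) comm_ring_1
begin

lift_definition one_hahn :: "('a, 'b) hahn" is "\<lambda>g. if g = 0 then 1 else 0"
  by (rule wfp_on_subset[where B = "{0}"]) (auto simp: wfp_on_def)

lift_definition times_hahn :: "('a, 'b) hahn \<Rightarrow> ('a, 'b) hahn \<Rightarrow> ('a, 'b) hahn" is
  "\<lambda>x y g. \<Sum>(h, k)\<in>{(h, k). x h \<noteq> 0 \<and> y k \<noteq> 0 \<and> h + k = g}. x h * y k"
proof -
  fix x y :: "'b \<Rightarrow> 'a"
  let ?P = "\<lambda>g. {(h, k). x h \<noteq> 0 \<and> y k \<noteq> 0 \<and> h + k = g}"
  assume "wfp_on {g. x g \<noteq> 0} (<)" "wfp_on {g. y g \<noteq> 0} (<)"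
  then have "wfp_on {a + b |a b. a \<in> {g. x g \<noteq> 0} \<and> b \<in> {g. y g \<noteq> 0}} (<)"
    by (rule wo_sumset)
  moreover have "{g. (\<Sum>(h, k)\<in>?P g. x h * y k) \<noteq> 0} \<subseteq>
      {a + b |a b. a \<in> {g. x g \<noteq> 0} \<and> b \<in> {g. y g \<noteq> 0}}"
  proof
    fix g assume "g \<in> {g. (\<Sum>(h, k)\<in>?P g. x h * y k) \<noteq> 0}"
    then have "(\<Sum>(h, k)\<in>?P g. x h * y k) \<noteq> 0" by simp
    then have "?P g \<noteq> {}" by (rule contrapos_nn) (simp only: sum.empty)
    then show "g \<in> {a + b |a b. a \<in> {g. x g \<noteq> 0} \<and> b \<in> {g. y g \<noteq> 0}}" by blast
  qed
  ultimately show "wfp_on {g. (\<Sum>(h, k)\<in>?P g. x h * y k) \<noteq> 0} (<)"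
    by (rule wfp_on_subset)
qed

lemma hcoeff_mult:
  fixes x y :: "('a, 'b) hahn"
  assumes "wfp_on A (<)" "wfp_on B (<)" "supp x \<subseteq> A" "supp y \<subseteq> B"
  shows "hcoeff (x * y) g = (\<Sum>(h, k)\<in>decomps A B g. hcoeff x h * hcoeff y k)"
proof -
  have "hcoeff (x * y) g = (\<Sum>(h, k)\<in>decomps (supp x) (supp y) g. hcoeff x h * hcoeff y k)"
    by (simp add: times_hahn.rep_eq decomps_def supp_def)
  also have "\<dots> = (\<Sum>(h, k)\<in>decomps A B g. hcoeff x h * hcoeff y k)"
    using assms
    by (intro sum.mono_neutral_left finite_decomps) (auto simp: decomps_def supp_def)
  finally show ?thesis .
qed

lemma supp_mult: "supp (x * y :: ('a, 'b) hahn) \<subseteq> {a + b | a b. a \<in> supp x \<and> b \<in> supp y}"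
proof
  fix g assume "g \<in> supp (x * y)"
  then have "decomps (supp x) (supp y) g \<noteq> {}"
    using hcoeff_mult[OF wo_supp wo_supp order_refl order_refl, of x y g]
    by (auto simp: supp_def[of "x * y"])
  then show "g \<in> {a + b | a b. a \<in> supp x \<and> b \<in> supp y}" by (auto simp: decomps_def)
qed

instance
proof
  fix x y z :: "('a, 'b) hahn"
  show comm: "x * y = y * x" for x y :: "('a, 'b) hahn"
  proof (rule hahn_eqI)
    fix g
    show "hcoeff (x * y) g = hcoeff (y * x) g"
      unfolding hcoeff_mult[OF wo_supp wo_supp order_refl order_refl]
      by (rule sum.reindex_bij_witness[of _ prod.swap prod.swap])
        (auto simp: decomps_def ac_simps)
  qed
  show "(x * y) * z = x * (y * z)"
  proof (rule hahn_eqI)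
    fix g
    let ?A = "supp x" and ?B = "supp y" and ?C = "supp z"
    let ?AB = "{a + b | a b. a \<in> ?A \<and> b \<in> ?B}" and ?BC = "{a + b | a b. a \<in> ?B \<and> b \<in> ?C}"
    let ?X = "hcoeff x" and ?Y = "hcoeff y" and ?Z = "hcoeff z"
    have "hcoeff (x * y * z) g = (\<Sum>(u, l)\<in>decomps ?AB ?C g. hcoeff (x * y) u * ?Z l)"
      by (intro hcoeff_mult wo_sumset wo_supp supp_mult order_refl)
    also have "\<dots> = (\<Sum>(u, l)\<in>decomps ?AB ?C g. \<Sum>(h, k)\<in>decomps ?A ?B u. ?X h * ?Y k * ?Z l)"
      by (simp add: hcoeff_mult[OF wo_supp wo_supp order_refl order_refl] sum_distrib_right
          case_prod_unfold)
    also have "\<dots> = (\<Sum>p\<in>decomps ?AB ?C g. \<Sum>q\<in>decomps ?A ?B (fst p).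
        ?X (fst q) * ?Y (snd q) * ?Z (snd p))"
      by (simp add: case_prod_unfold)
    also have "\<dots> = (\<Sum>(p, q)\<in>Sigma (decomps ?AB ?C g) (\<lambda>p. decomps ?A ?B (fst p)).
        ?X (fst q) * ?Y (snd q) * ?Z (snd p))"
      by (rule sum.Sigma) (auto intro!: finite_decomps wo_sumset wo_supp)
    also have "\<dots> = (\<Sum>(p, q)\<in>Sigma (decomps ?A ?BC g) (\<lambda>p. decomps ?B ?C (snd p)).
        ?X (fst p) * (?Y (fst q) * ?Z (snd q)))"
      by (rule sum.reindex_bij_witness[of _
            "\<lambda>((h, v), (k, l)). ((h + k, l), (h, k))" "\<lambda>((u, l), (h, k)). ((h, k + l), (k, l))"])
        (auto simp: decomps_def ac_simps)
    also have "\<dots> = (\<Sum>p\<in>decomps ?A ?BC g. \<Sum>q\<in>decomps ?B ?C (snd p).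
        ?X (fst p) * (?Y (fst q) * ?Z (snd q)))"
      by (rule sum.Sigma[symmetric]) (auto intro!: finite_decomps wo_sumset wo_supp)
    also have "\<dots> = (\<Sum>(h, v)\<in>decomps ?A ?BC g. ?X h * hcoeff (y * z) v)"
      by (simp add: hcoeff_mult[OF wo_supp wo_supp order_refl order_refl] sum_distrib_left
          case_prod_unfold)
    also have "\<dots> = hcoeff (x * (y * z)) g"
      by (intro hcoeff_mult[symmetric] wo_sumset wo_supp supp_mult order_refl)
    finally show "hcoeff (x * y * z) g = hcoeff (x * (y * z)) g" .
  qed
  show "1 * x = x"
  proof (rule hahn_eqI)
    fix g
    have one: "supp (1 :: ('a, 'b) hahn) \<subseteq> {0}" by (auto simp: supp_def one_hahn.rep_eq)
    have wo1: "wfp_on {0 :: 'b} (<)" by (simp add: wfp_on_def)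
    have "hcoeff (1 * x) g = (\<Sum>(h, k)\<in>decomps {0} (supp x) g. hcoeff 1 h * hcoeff x k)"
      by (intro hcoeff_mult wo1 wo_supp one order_refl)
    also have "decomps {0} (supp x) g = (if g \<in> supp x then {(0, g)} else {})"
      by (auto simp: decomps_def)
    finally show "hcoeff (1 * x) g = hcoeff x g"
      by (auto simp: one_hahn.rep_eq hcoeff_eq_0 split: if_splits)
  qed
  show "(x + y) * z = x * z + y * z"
  proof (rule hahn_eqI)
    fix g
    have wo: "wfp_on (supp x \<union> supp y) (<)" by (intro wo_Un wo_supp)
    have "supp (x + y) \<subseteq> supp x \<union> supp y" by (auto simp: supp_def plus_hahn.rep_eq)
    note * = hcoeff_mult[OF wo wo_supp _ order_refl, of _ z g]
    show "hcoeff ((x + y) * z) g = hcoeff (x * z + y * z) g"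
      using \<open>supp (x + y) \<subseteq> _\<close>
      by (simp add: plus_hahn.rep_eq * case_prod_unfold algebra_simps sum.distrib)
  qed
  show "(0 :: ('a, 'b) hahn) \<noteq> 1"
    by (metis one_hahn.rep_eq zero_hahn.rep_eq zero_neq_one)
qed

end

text \<open>The inverse of \<^term>\<open>1 - e\<close> for \<^term>\<open>e\<close> with positive support, by recursion on the
  well-ordered monoid generated by the support.\<close>

lemma hahn_one_minus_inverse:
  fixes e :: "('a::comm_ring_1, 'g::linordered_ab_group_add) hahn"
  assumes pos: "\<And>g. g \<in> supp e \<Longrightarrow> 0 < g"
  shows "\<exists>y. (1 - e) * y = 1"
proof -
  define S where "S = supp e"
  define M where "M = sum_list ` lists S"
  have woS: "wfp_on S (<)" unfolding S_def by (rule wo_supp)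
  have woM: "wfp_on M (<)" unfolding M_def by (rule wo_monoid_gen) (use woS pos S_def in auto)
  have M0: "0 \<in> M" unfolding M_def by (force intro!: image_eqI[of _ _ "[]"])
  have MS: "s + h \<in> M" if "s \<in> S" "h \<in> M" for s h
    using that unfolding M_def by (force intro!: image_eqI[of _ _ "_ # _"])
  define R where "R = {(h, g). h < g \<and> h \<in> M \<and> g \<in> M}"
  have wfR: "wf R"
    using woM unfolding wfp_on_iff_wfp[of M] wfp_def R_def by simp
  define F :: "('g \<Rightarrow> 'a) \<Rightarrow> 'g \<Rightarrow> 'a" where
    "F f g = (if g = 0 then 1 else 0) + (\<Sum>(s, h)\<in>decomps S M g. hcoeff e s * f h)" for f g
  define y where "y = wfrec R F"
  have y: "y g = F y g" for g
  proof -
    have "y g = F (cut y R g) g" unfolding y_def by (rule wfrec[OF wfR])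
    also have "\<dots> = F y g"
      unfolding F_def
    proof (intro arg_cong2[of _ _ _ _ "(+)"] sum.cong refl)
      fix p assume "p \<in> decomps S M g"
      then obtain s h where p: "p = (s, h)" "s \<in> S" "h \<in> M" "s + h = g"
        by (auto simp: decomps_def)
      then have "h < g" using pos[of s] S_def by auto
      then have "(h, g) \<in> R" using p MS by (auto simp: R_def)
      then show "(case p of (s, h) \<Rightarrow> hcoeff e s * cut y R g h) =
          (case p of (s, h) \<Rightarrow> hcoeff e s * y h)"
        using p(1) by (simp add: cut_apply)
    qed
    finally show ?thesis .
  qed
  have yM: "{g. y g \<noteq> 0} \<subseteq> M"
  proof (intro subsetI, rule ccontr)
    fix g assume g: "g \<in> {g. y g \<noteq> 0}" "g \<notin> M"
    then have "decomps S M g = {}" "g \<noteq> 0" using MS M0 by (auto simp: decomps_def)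
    then have "y g = 0" by (subst y) (simp add: F_def)
    with g show False by simp
  qed
  define Y where "Y = Abs_hahn y"
  have Y: "hcoeff Y = y"
    unfolding Y_def by (rule Abs_hahn_inverse) (use wfp_on_subset[OF woM yM] in simp)
  have "Y = 1 + e * Y"
  proof (rule hahn_eqI)
    fix g
    have "hcoeff (e * Y) g = (\<Sum>(h, k)\<in>decomps S M g. hcoeff e h * hcoeff Y k)"
      by (rule hcoeff_mult[OF woS woM]) (use yM in \<open>auto simp: S_def supp_def Y\<close>)
    then show "hcoeff Y g = hcoeff (1 + e * Y) g"
      using y[of g] by (simp add: plus_hahn.rep_eq one_hahn.rep_eq Y F_def)
  qed
  then have "(1 - e) * Y = 1" by (simp add: algebra_simps)
  then show ?thesis ..
qed

lemma hcoeff_hmonom_mult: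
  fixes x :: "('a::comm_ring_1, 'g::linordered_ab_group_add) hahn"
  shows "hcoeff (hmonom c h * x) g = c * hcoeff x (g - h)"
proof -
  have "hcoeff (hmonom c h * x) g
      = (\<Sum>(i, k)\<in>decomps {h} (supp x) g. hcoeff (hmonom c h) i * hcoeff x k)"
    by (intro hcoeff_mult wo_supp order_refl)
      (auto simp: wfp_on_def supp_def hmonom.rep_eq split: if_splits)
  also have "decomps {h} (supp x) g = (if g - h \<in> supp x then {(h, g - h)} else {})"
    by (auto simp: decomps_def algebra_simps)
  finally show ?thesis by (auto simp: hmonom.rep_eq hcoeff_eq_0 split: if_splits)
qed

lemma hahn_ex_inverse:
  fixes x :: "('a::field, 'g::linordered_ab_group_add) hahn"
  assumes "x \<noteq> 0"
  shows "\<exists>y. x * y = 1"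
proof -
  have "supp x \<noteq> {}" using assms by (auto simp: supp_def zero_hahn.rep_eq intro!: hahn_eqI)
  then obtain m where m: "m \<in> supp x" "\<And>g. g < m \<Longrightarrow> g \<notin> supp x"
    using wo_supp[of x] unfolding wfp_on_iff_ex_minimal by blast
  define u where "u = hmonom (inverse (hcoeff x m)) (- m) * x"
  define e where "e = 1 - u"
  have "0 < g" if "g \<in> supp e" for g
  proof (rule ccontr)
    assume "\<not> 0 < g"
    then consider "g = 0" | "g < 0" by fastforce
    then have "hcoeff e g = 0"
    proof cases
      case 1
      then show ?thesis using m(1)
        by (simp add: e_def u_def minus_hahn.rep_eq one_hahn.rep_eq hcoeff_hmonom_mult supp_def)
    next
      case 2
      then have "g + m \<notin> supp x" by (intro m(2)) simp
      then show ?thesis using 2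
        by (simp add: e_def u_def minus_hahn.rep_eq one_hahn.rep_eq hcoeff_hmonom_mult supp_def)
    qed
    with that show False by (simp add: supp_def)
  qed
  then obtain y where "(1 - e) * y = 1" using hahn_one_minus_inverse by blast
  then have "x * (hmonom (inverse (hcoeff x m)) (- m) * y) = 1"
    by (simp add: e_def u_def algebra_simps)
  then show ?thesis ..
qed

instantiation hahn :: (field, linordered_ab_group_add) field
begin

definition inverse_hahn :: "('a, 'b) hahn \<Rightarrow> ('a, 'b) hahn" where
  "inverse_hahn x = (if x = 0 then 0 else (SOME y. x * y = 1))"

definition divide_hahn :: "('a, 'b) hahn \<Rightarrow> ('a, 'b) hahn \<Rightarrow> ('a, 'b) hahn" where
  "divide_hahn x y = x * inverse y"

instance
proof
  fix x :: "('a, 'b) hahn"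
  assume "x \<noteq> 0"
  then show "inverse x * x = 1"
    unfolding inverse_hahn_def using someI_ex[OF hahn_ex_inverse[OF \<open>x \<noteq> 0\<close>]]
    by (simp add: mult.commute)
qed (simp_all add: divide_hahn_def inverse_hahn_def)

end

text \<open>For a subgroup \<open>\<Gamma>\<close> of the exponent group, the Hahn field over \<open>\<Gamma>\<close> is identified with the
  set of series supported in \<open>\<Gamma>\<close>.\<close>

definition hahn_supported_in :: "'g::linorder set \<Rightarrow> ('a::zero, 'g) hahn set" where
  "hahn_supported_in \<Gamma> = {x. supp x \<subseteq> \<Gamma>}"

definition Gamma :: "nat \<Rightarrow> nat \<Rightarrow> rat set" where
  "Gamma p m = {of_int a / (of_nat m * of_nat p ^ k) | a k. True}"


section \<open>The rational function field over the prime field as a subfield of the Hahn field\<close>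

text \<open>The maps below are ring homomorphisms if the characteristic of \<^typ>\<open>'a\<close> is \<open>CARD('p)\<close>:
  then residues embed via their integer representatives, and the indeterminate goes to
  \<open>hmonom 1 1\<close>, the series \<open>t\<close>.\<close>

definition of_mod_ring :: "'p::prime_card mod_ring \<Rightarrow> 'a::ring_1" where
  "of_mod_ring a = of_int (to_int_mod_ring a)"

definition hahn_of_poly :: "'p::prime_card mod_ring poly \<Rightarrow> ('a::field, rat) hahn" where
  "hahn_of_poly q = poly (map_poly (\<lambda>a. hmonom (of_mod_ring a) 0) q) (hmonom 1 1)"

definition hahn_of_ratfun :: "'p::prime_card mod_ring poly fract \<Rightarrow> ('a::field, rat) hahn" where
  "hahn_of_ratfun r =
     (let (a, b) = quot_of_fract r in hahn_of_poly a / hahn_of_poly b)"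

section \<open>Algorithms\<close>

text \<open>Partial recursive functions, evaluated on argument lists by a big-step relation; a pair
  \<open>r xs\<close> without value is a diverging computation.\<close>

datatype recf = Zero | Succ | Proj nat | Comp recf "recf list" | PrimRec recf recf | Mu recf

inductive computes :: "recf \<Rightarrow> nat list \<Rightarrow> nat \<Rightarrow> bool" where
  "computes Zero xs 0"
| "computes Succ [x] (Suc x)"
| "i < length xs \<Longrightarrow> computes (Proj i) xs (xs ! i)"
| "list_all2 (\<lambda>g y. computes g xs y) gs ys \<Longrightarrow> computes f ys z \<Longrightarrow> computes (Comp f gs) xs z"
| "computes f xs y \<Longrightarrow> computes (PrimRec f g) (0 # xs) y"
| "computes (PrimRec f g) (n # xs) y \<Longrightarrow> computes g (n # y # xs) z \<Longrightarrow>
     computes (PrimRec f g) (Suc n # xs) z"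
| "computes f (n # xs) 0 \<Longrightarrow> (\<forall>k<n. \<exists>v. computes f (k # xs) (Suc v)) \<Longrightarrow> computes (Mu f) xs n"

inductive_cases computes_elims:
  "computes Zero xs y" "computes Succ xs y" "computes (Proj i) xs y" "computes (Comp f gs) xs y"
  "computes (PrimRec f g) (0 # xs) y" "computes (PrimRec f g) (Suc n # xs) y"
  "computes (Mu f) xs y"

lemma computes_deterministic: "computes r xs y \<Longrightarrow> computes r xs z \<Longrightarrow> y = z"
proof (induction arbitrary: z rule: computes.induct)
  case (4 xs gs ys f y)
  from "4.prems" obtain ys' where ys': "list_all2 (\<lambda>g y. computes g xs y) gs ys'" "computes f ys' z"
    by (rule computes_elims)
  have "ys = ys'"
    using 4(1) ys'(1) by (auto simp: list_all2_conv_all_nth intro!: nth_equalityI)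
  then show ?case using "4.IH"(2) ys'(2) by blast
next
  case (6 f g n xs y w)
  from 6(5) obtain y' where y': "computes (PrimRec f g) (n # xs) y'" "computes g (n # y' # xs) z"
    by (rule computes_elims)
  then show ?case using 6(3)[OF y'(1)] 6(4) by blast
next
  case (7 f n xs)
  from 7(4) have z: "computes f (z # xs) 0" "\<forall>k<z. \<exists>v. computes f (k # xs) (Suc v)"
    by (auto elim: computes_elims)
  show ?case
  proof (rule linorder_cases[of n z])
    assume "n < z"
    then show ?thesis using z(2) 7(2) by (metis nat.distinct(1))
  next
    assume "z < n"
    then show ?thesis using z(1) 7(3) by (metis nat.distinct(1))
  qed
next
  case (1 xs)
  then show ?case by (rule computes_elims) simp
next
  case (2 x)
  then show ?case by (rule computes_elims) simp
next
  case (3 i xs)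
  from "3.prems" show ?case by (rule computes_elims) simp
next
  case (5 f xs y g)
  from "5.prems" have "computes f xs z" by (rule computes_elims)
  then show ?case by (rule "5.IH")
qed

text \<open>Inputs are coded by their normal forms: residues in \<open>{0..<p}\<close>, coefficient lists without
  trailing zeros, and fractions in lowest terms with monic denominator.\<close>

definition code_poly :: "'p::prime_card mod_ring poly \<Rightarrow> nat" where
  "code_poly q = list_encode (map (\<lambda>a. nat (to_int_mod_ring a)) (coeffs q))"

definition code_ratfun :: "'p::prime_card mod_ring poly fract \<Rightarrow> nat" where
  "code_ratfun r = (let (a, b) = quot_of_fract r in prod_encode (code_poly a, code_poly b))"

definition code_input :: "'p::prime_card mod_ring poly fract poly \<Rightarrow> nat" where
  "code_input f = list_encode (map code_ratfun (coeffs f))"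

lemma inj_code_poly: "inj code_poly"
proof (rule injI)
  fix q r :: "'p::prime_card mod_ring poly"
  have "inj (\<lambda>a :: 'p mod_ring. nat (to_int_mod_ring a))"
    by (rule injI, transfer) auto
  moreover assume "code_poly q = code_poly r"
  ultimately show "q = r"
    by (simp add: code_poly_def list_encode_eq inj_map_eq_map coeffs_eq_iff)
qed

lemma inj_code_ratfun: "inj code_ratfun"
proof (rule injI)
  fix q r :: "'p::prime_card mod_ring poly fract"
  assume "code_ratfun q = code_ratfun r"
  then have "code_poly (fst (quot_of_fract q)) = code_poly (fst (quot_of_fract r))"
    "code_poly (snd (quot_of_fract q)) = code_poly (snd (quot_of_fract r))"
    by (simp_all add: code_ratfun_def case_prod_unfold Let_def)
  then have "quot_of_fract q = quot_of_fract r"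
    by (intro prod_eqI injD[OF inj_code_poly])
  then show "q = r" by (metis quot_to_fract_quot_of_fract)
qed

lemma inj_code_input: "inj code_input"
proof (rule injI)
  fix f g :: "'p::prime_card mod_ring poly fract poly"
  assume "code_input f = code_input g"
  then have "map code_ratfun (coeffs f) = map code_ratfun (coeffs g)"
    unfolding code_input_def list_encode_eq .
  then have "coeffs f = coeffs g"
    unfolding inj_map_eq_map[OF inj_code_ratfun] .
  then show "f = g"
    unfolding coeffs_eq_iff .
qed

end

theory Submission
  imports "HOL-Algebra.Algebraic_Closure_Type" Defs
begin

text \<open>
  The number produced for an input \<open>f\<close> is \<open>p ^ fact N - 1\<close>, where \<open>N\<close> is the code of \<open>f\<close>. It depends
  on \<open>f\<close> only through an upper bound for its degree, because a code of a list is at least as large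
  as the length of the list. So no polynomial arithmetic has to be carried out by a recursive
  function.

  The point is that a root \<open>x\<close> of \<open>f\<close> can only have exponents whose denominators, apart from powers
  of \<open>p\<close>, are controlled by \<open>n = degree f\<close>. Let \<open>K\<close> be an algebraic closure of the coefficient
  field. A character \<open>\<chi>\<close> from the additive group of the rationals to the units of \<open>K\<close> yields a field
  homomorphism that multiplies the coefficient of \<open>t\<^sup>g\<close> by \<open>\<chi> g\<close>
  (\<open>field_hom_hahn_twist\<close>). If \<open>\<chi> 1 = 1\<close>, the coefficients of \<open>f\<close>, which are rational functions in
  \<open>t\<close>, have the same image under the twists by all powers of \<open>\<chi>\<close>. All these twists therefore send
  \<open>x\<close> to roots of one polynomial of degree \<open>n\<close>, two of the first \<open>n + 1\<close> images coincide, and hence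
  \<open>\<chi> g ^ k = 1\<close> on the whole support of \<open>x\<close> for a single \<open>k\<close> with \<open>0 < k \<le> n\<close>
  (\<open>root_support_char_finite_order\<close>).

  Now let \<open>g = a / b\<close> in lowest terms be in the support, and let a power \<open>Q\<close> of a prime other than
  \<open>p\<close> divide \<open>b\<close>. There is a primitive root of unity of order \<open>Q\<close> in \<open>K\<close>, and, as roots can be
  extracted in \<open>K\<close>, a character with \<open>\<chi> 1 = 1\<close> that takes \<open>1 / b\<close> to this root of unity
  (\<open>ex_rat_character\<close>). Then \<open>\<chi> g\<close> has order \<open>Q\<close>, so \<open>Q\<close> divides \<open>k\<close> and \<open>Q \<le> n\<close>
  (\<open>prime_power_dvd_denominator_le_degree\<close>). By Euler's theorem \<open>Q\<close> divides
  \<open>p ^ totient Q - 1\<close> and, as \<open>totient Q \<le> N\<close>, also \<open>p ^ fact N - 1\<close>. This holds for all such \<open>Q\<close>,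
  so the part of \<open>b\<close> prime to \<open>p\<close> divides \<open>p ^ fact N - 1\<close>.
\<close>

section \<open>Roots of unity and characters\<close>

text \<open>
  The root of unity is a root of the cyclotomic polynomial \<open>\<Sum>k<q. X ^ (k * q ^ r)\<close>; it cannot have
  order dividing \<open>q ^ r\<close>, since the polynomial would then take the value \<open>q \<noteq> 0\<close> there.
\<close>

lemma ex_prime_power_root_of_unity:
  assumes "prime q" "(of_nat q :: 'k::alg_closed_field) \<noteq> 0"
  obtains z :: "'k::alg_closed_field" where "z ^ (q ^ Suc r) = 1" "z ^ (q ^ r) \<noteq> 1"
proof -
  have q: "q > 1" using assms(1) by (rule prime_gt_1_nat)
  obtain w :: 'k where w: "(\<Sum>k\<le>q - 1. 1 * w ^ k) = 0"
    using alg_closed[of "q - 1" "\<lambda>_. 1"] q by auto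
  have "{..q - 1} = {..<q}" using q by auto
  with w have w0: "(\<Sum>k<q. w ^ k) = 0" by simp
  have "w \<noteq> 1" using w0 assms(2) by auto
  have "w ^ q - 1 = (w - 1) * (\<Sum>k<q. w ^ k)" by (rule power_diff_1_eq)
  then have "w ^ q = 1" using w0 by simp
  obtain z where "z ^ (q ^ r) = w" using nth_root_exists[of "q ^ r" w] q by auto
  moreover have "z ^ (q ^ Suc r) = (z ^ (q ^ r)) ^ q" by (simp only: power_Suc2 power_mult)
  ultimately show thesis using \<open>w \<noteq> 1\<close> \<open>w ^ q = 1\<close> that[of z] by metis
qed

lemma power_gcd_eq_1:
  fixes z :: "'k::field"
  assumes "z ^ a = 1" "z ^ b = 1"
  shows "z ^ gcd a b = 1"
proof (cases "a = 0")
  case False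
  then obtain x y where "a * x = b * y + gcd a b" using bezout_nat by blast
  then have "(z ^ a) ^ x = (z ^ b) ^ y * z ^ gcd a b" by (simp flip: power_mult power_add)
  then show ?thesis using assms by simp
qed (use assms in auto)

lemma prime_power_dvd_exponent:
  fixes z :: "'k::field"
  assumes "prime q" "z ^ (q ^ Suc r) = 1" "z ^ (q ^ r) \<noteq> 1" "z ^ k = 1"
  shows "q ^ Suc r dvd k"
proof -
  have 1: "z ^ gcd k (q ^ Suc r) = 1" using assms by (intro power_gcd_eq_1)
  obtain j where j: "j \<le> Suc r" "gcd k (q ^ Suc r) = q ^ j"
    using divides_primepow_nat[OF assms(1), of "gcd k (q ^ Suc r)" "Suc r"] by auto
  have "j = Suc r"
  proof (rule ccontr)
    assume "j \<noteq> Suc r"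
    then have "q ^ j dvd q ^ r" using j(1) by (simp add: le_imp_power_dvd)
    then obtain c where "q ^ r = q ^ j * c" ..
    then show False using 1 j(2) assms(3) by (simp add: power_mult)
  qed
  then show ?thesis using j(2) by (metis gcd_dvd1)
qed

locale group_character =
  fixes \<chi> :: "'g::ab_group_add \<Rightarrow> 'k::field"
  assumes char_add: "\<chi> (g + h) = \<chi> g * \<chi> h" and char_0: "\<chi> 0 = 1"
begin

lemma char_nz: "\<chi> g \<noteq> 0"
  using char_add[of g "- g"] char_0 by auto

lemma char_power: "group_character (\<lambda>g. \<chi> g ^ k)"
  by unfold_locales (simp_all add: char_add char_0 power_mult_distrib)

end

lemma char_of_int_mult:
  fixes \<chi> :: "'g::ring_1 \<Rightarrow> 'k::field"
  assumes "group_character \<chi>"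
  shows "\<chi> (of_int j * g) = \<chi> g powi j"
proof -
  interpret group_character \<chi> by fact
  show ?thesis
  proof (induction j rule: int_induct[of _ 0])
    case base
    show ?case by (simp add: char_0)
  next
    case (step1 i)
    then show ?case by (simp add: distrib_right char_add power_int_add_1 char_nz)
  next
    case (step2 i)
    have "\<chi> (of_int i * g) = \<chi> (of_int (i - 1) * g) * \<chi> g"
      by (simp add: left_diff_distrib flip: char_add)
    then show ?case using step2 char_nz[of g] power_int_add_1[of "\<chi> g" "i - 1"] by simp
  qed
qed

text \<open>
  The rationals are the union of the cyclic groups generated by \<open>1 / (b * fact k)\<close>. A character is
  the same as a choice of values \<open>w k\<close> at these generators that are compatible, in the sense that
  \<open>w (Suc k) ^ Suc k = w k\<close>; starting with \<open>w 0 = z\<close>, they are found by extracting roots.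
\<close>

lemma ex_rat_character:
  fixes z :: "'k::alg_closed_field"
  assumes "b > 0" "z ^ b = 1"
  obtains \<chi> :: "rat \<Rightarrow> 'k" where "group_character \<chi>" "\<chi> 1 = 1" "\<chi> (1 / of_nat b) = z"
proof -
  define B :: "nat \<Rightarrow> nat" where "B k = b * fact k" for k
  have BS: "B (Suc k) = B k * Suc k" for k by (simp add: B_def algebra_simps)
  have Bpos: "B k > 0" for k using assms(1) by (simp add: B_def)
  have "\<exists>w :: nat \<Rightarrow> 'k. \<forall>k. (k = 0 \<longrightarrow> w k = z) \<and> w (Suc k) ^ Suc k = w k"
    using nth_root_exists by (intro dependent_nat_choice) blast+
  then obtain w :: "nat \<Rightarrow> 'k" where w0: "w 0 = z" and wS: "\<And>k. w (Suc k) ^ Suc k = w k"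
    by metis
  have wB: "w k ^ B k = 1" for k
  proof (induction k)
    case 0
    then show ?case using assms(2) w0 by (simp add: B_def)
  next
    case (Suc k)
    have "w (Suc k) ^ B (Suc k) = (w (Suc k) ^ Suc k) ^ B k"
      unfolding BS by (metis mult.commute power_mult)
    then show ?case using Suc wS by simp
  qed
  have wnz: "w k \<noteq> 0" for k using wB[of k] Bpos[of k] by (metis power_0_left less_irrefl zero_neq_one)
  \<comment> \<open>The value at \<open>x\<close> computed at level \<open>k\<close>; meaningful only if \<open>x\<close> is a multiple of the
    generator at this level, and then the same at all higher levels.\<close>
  define v where "v x k = w k powi \<lfloor>x * of_nat (B k)\<rfloor>" for x :: rat and k
  have v_Suc: "x * of_nat (B (Suc k)) \<in> \<int> \<and> v x (Suc k) = v x k" if "x * of_nat (B k) \<in> \<int>" for x k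
  proof -
    from that obtain i where i: "x * of_nat (B k) = of_int i" by (auto elim: Ints_cases)
    have e: "x * of_nat (B (Suc k)) = of_int (int (Suc k) * i)"
      unfolding BS using i by (simp add: algebra_simps)
    have "v x (Suc k) = w (Suc k) powi (int (Suc k) * i)"
      unfolding v_def e floor_of_int ..
    also have "\<dots> = w k powi i" by (simp only: power_int_mult power_int_of_nat wS)
    finally have "v x (Suc k) = v x k" unfolding v_def i floor_of_int .
    then show ?thesis unfolding e by simp
  qed
  have v_le: "x * of_nat (B l) \<in> \<int> \<and> v x l = v x k" if "x * of_nat (B k) \<in> \<int>" "k \<le> l" for x k l
    using that(2) by (induction rule: dec_induct) (use that(1) v_Suc in auto)
  \<comment> \<open>A level at which \<open>x\<close> has appeared: \<open>fact k\<close> is a multiple of the denominator \<open>k\<close>.\<close>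
  define d where "d x = nat (snd (quotient_of x))" for x :: rat
  have d: "x * of_nat (B (d x)) \<in> \<int>" for x
  proof -
    obtain n c where nc: "quotient_of x = (n, c)" by fastforce
    then have c: "c > 0" "x * of_int c = of_int n"
      using quotient_of_denom_pos[OF nc] quotient_of_div[OF nc] by simp_all
    have "nat c dvd fact (nat c)" using c(1) by (intro dvd_fact) auto
    then have "nat c dvd B (nat c)" unfolding B_def by simp
    then obtain e where e: "B (nat c) = nat c * e" ..
    have "of_nat (B (d x)) = of_int c * (of_nat e :: rat)"
      using c(1) by (simp add: d_def nc e)
    then have "x * of_nat (B (d x)) = (x * of_int c) * of_nat e" by simp
    also have "\<dots> = of_int (n * int e)" using c(2) by simp
    finally have "x * of_nat (B (d x)) = of_int (n * int e)" .
    then show ?thesis by simp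
  qed
  define \<chi> where "\<chi> x = v x (d x)" for x
  have chi: "x * of_nat (B k) \<in> \<int>" "\<chi> x = v x k" if "d x \<le> k" for x k
    using v_le[OF d that] unfolding \<chi>_def by auto
  have chi0: "\<chi> x = v x 0" if "x * of_nat b \<in> \<int>" for x
    using v_le[of x 0 "d x"] that unfolding \<chi>_def B_def by simp
  have "group_character \<chi>"
  proof
    fix x y :: rat
    define k where "k = d x + d y + d (x + y)"
    note X = chi[of x k] and Y = chi[of y k] and XY = chi[of "x + y" k]
    obtain i j where ij: "x * of_nat (B k) = of_int i" "y * of_nat (B k) = of_int j"
      using X(1) Y(1) unfolding k_def by (auto elim!: Ints_cases)
    have "(x + y) * of_nat (B k) = of_int (i + j)" using ij by (simp add: algebra_simps)
    then show "\<chi> (x + y) = \<chi> x * \<chi> y"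
      using X(2) Y(2) XY(2) ij wnz[of k] unfolding k_def[symmetric] v_def
      by (simp add: k_def power_int_add)
  next
    show "\<chi> 0 = 1" using chi0[of 0] by (simp add: v_def)
  qed
  moreover have "\<chi> 1 = 1" using chi0[of 1] w0 assms(2) by (simp add: v_def B_def)
  moreover have "\<chi> (1 / of_nat b) = z" using chi0[of "1 / of_nat b"] assms(1) w0
    by (simp add: v_def B_def)
  ultimately show thesis by (rule that)
qed

section \<open>Twisting Hahn series by a character\<close>

text \<open>
  The twist includes the passage to the algebraic closure, where enough characters exist.
\<close>

lift_definition hahn_twist ::
  "('g::linorder \<Rightarrow> 'a::field alg_closure) \<Rightarrow> ('a, 'g) hahn \<Rightarrow> ('a alg_closure, 'g) hahn"
  is "\<lambda>\<chi> x g. \<chi> g * to_ac (x g)"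
  by (erule wfp_on_subset) auto

lemma supp_hahn_twist: "supp (hahn_twist \<chi> x) \<subseteq> supp x"
  by (auto simp: supp_def hahn_twist.rep_eq)

lemma hahn_twist_eq_iff:
  "hahn_twist \<chi> x = hahn_twist \<psi> x \<longleftrightarrow> (\<forall>g\<in>supp x. \<chi> g = \<psi> g)"
  by (auto simp: hcoeff_inject[symmetric] hahn_twist.rep_eq fun_eq_iff supp_def)

lemma field_hom_hahn_twist:
  fixes \<chi> :: "'g::linordered_ab_group_add \<Rightarrow> 'a::field alg_closure"
  assumes "group_character \<chi>"
  shows "field_hom (hahn_twist \<chi>)"
proof -
  interpret group_character \<chi> by fact
  show ?thesis
  proof
    fix x y :: "('a, 'g) hahn"
    show "hahn_twist \<chi> (x * y) = hahn_twist \<chi> x * hahn_twist \<chi> y"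
    proof (rule hahn_eqI)
      fix g
      note D = hcoeff_mult[OF wo_supp[of x] wo_supp[of y]]
      have "hcoeff (hahn_twist \<chi> x * hahn_twist \<chi> y) g =
          (\<Sum>(h, k)\<in>decomps (supp x) (supp y) g.
            (\<chi> h * to_ac (hcoeff x h)) * (\<chi> k * to_ac (hcoeff y k)))"
        by (simp only: D[OF supp_hahn_twist supp_hahn_twist] hahn_twist.rep_eq)
      also have "\<dots> = (\<Sum>(h, k)\<in>decomps (supp x) (supp y) g.
            \<chi> g * to_ac (hcoeff x h * hcoeff y k))"
        by (rule sum.cong) (auto simp: decomps_def char_add)
      also have "\<dots> = hcoeff (hahn_twist \<chi> (x * y)) g"
        by (simp add: hahn_twist.rep_eq D[OF order_refl order_refl] to_ac_sum
            sum_distrib_left case_prod_unfold)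
      finally show "hcoeff (hahn_twist \<chi> (x * y)) g =
          hcoeff (hahn_twist \<chi> x * hahn_twist \<chi> y) g" ..
    qed
  qed (auto intro!: hahn_eqI simp: hahn_twist.rep_eq plus_hahn.rep_eq zero_hahn.rep_eq
      one_hahn.rep_eq algebra_simps char_0)
qed

lemma group_character_1: "group_character (\<lambda>_. 1)"
  by unfold_locales auto

text \<open>
  A series is supported in the kernel of \<open>\<chi>\<close> iff its twists by \<open>\<chi>\<close> and by the trivial character
  agree. Two field homomorphisms agree on a subfield, so inverses need not be computed.
\<close>

lemma supp_divide_subset_char_kernel:
  fixes x y :: "('a::field, 'g::linordered_ab_group_add) hahn"
  assumes "group_character (\<chi> :: 'g \<Rightarrow> 'a alg_closure)"
    and "supp x \<subseteq> {g. \<chi> g = 1}" "supp y \<subseteq> {g. \<chi> g = 1}"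
  shows "supp (x / y) \<subseteq> {g. \<chi> g = 1}"
proof -
  interpret T: field_hom "hahn_twist \<chi>" by (rule field_hom_hahn_twist) fact
  interpret I: field_hom "hahn_twist (\<lambda>_::'g. 1 :: 'a alg_closure)"
    by (rule field_hom_hahn_twist) (rule group_character_1)
  have "hahn_twist \<chi> x = hahn_twist (\<lambda>_. 1) x" "hahn_twist \<chi> y = hahn_twist (\<lambda>_. 1) y"
    using assms(2,3) unfolding hahn_twist_eq_iff by auto
  then have "hahn_twist \<chi> (x / y) = hahn_twist (\<lambda>_. 1) (x / y)"
    by (simp add: divide_inverse T.hom_mult T.hom_inverse I.hom_mult I.hom_inverse)
  then show ?thesis unfolding hahn_twist_eq_iff by auto
qed

text \<open>
  The twists of \<open>x\<close> by \<open>\<chi> ^ 0, \<dots>, \<chi> ^ degree P\<close> are too many roots for one polynomial to be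
  distinct, and twists by \<open>\<chi> ^ i\<close> and \<open>\<chi> ^ j\<close> coincide only if \<open>\<chi> ^ (j - i)\<close> is trivial on the
  support.
\<close>

lemma root_support_char_finite_order:
  fixes P :: "('a::field, 'g::linordered_ab_group_add) hahn poly"
  assumes "group_character (\<chi> :: 'g \<Rightarrow> 'a alg_closure)"
    and P: "P \<noteq> 0" "\<And>i. supp (coeff P i) \<subseteq> {g. \<chi> g = 1}" and x: "poly P x = 0"
  obtains k where "0 < k" "k \<le> degree P" "\<And>g. g \<in> supp x \<Longrightarrow> \<chi> g ^ k = 1"
proof -
  interpret \<chi>: group_character \<chi> by fact
  define tw where "tw k = hahn_twist (\<lambda>g. \<chi> g ^ k)" for k :: nat
  have tw: "field_hom (tw k)" for k
    unfolding tw_def by (rule field_hom_hahn_twist) (rule \<chi>.char_power)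
  define Q where "Q = map_poly (tw 0) P"
  interpret T0: field_hom "tw 0" by (rule tw)
  have tw0: "tw 0 c = 0 \<longleftrightarrow> c = 0" for c by simp
  have Q: "Q \<noteq> 0" "degree Q \<le> degree P"
    using P(1) tw0 by (auto simp: Q_def poly_eq_iff coeff_map_poly degree_map_poly_le)
  have root: "poly Q (tw k x) = 0" for k
  proof -
    interpret Tk: field_hom "tw k" by (rule tw)
    have "Q = map_poly (tw k) P"
      unfolding Q_def poly_eq_iff coeff_map_poly[of "tw 0", OF T0.hom_zero]
        coeff_map_poly[of "tw k", OF Tk.hom_zero]
      using P(2) unfolding tw_def hahn_twist_eq_iff by (fastforce simp: power_one)
    then have "poly Q (tw k x) = tw k (poly P x)" by (simp add: Tk.poly_map_poly)
    then show ?thesis using x by simp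
  qed
  have "\<not> inj_on (\<lambda>k. tw k x) {..degree P}"
  proof
    assume inj: "inj_on (\<lambda>k. tw k x) {..degree P}"
    have "Suc (degree P) = card ((\<lambda>k. tw k x) ` {..degree P})" using card_image[OF inj] by simp
    also have "\<dots> \<le> card {y. poly Q y = 0}"
      by (rule card_mono) (use root poly_roots_finite[OF Q(1)] in auto)
    also have "\<dots> \<le> degree Q" by (rule card_poly_roots_bound) (rule Q(1))
    finally show False using Q(2) by simp
  qed
  then obtain i j where ij: "i < j" "j \<le> degree P" "tw i x = tw j x"
    unfolding inj_on_def by (metis atMost_iff nat_neq_iff)
  show thesis
  proof (rule that[of "j - i"])
    fix g assume "g \<in> supp x"
    then have "\<chi> g ^ i = \<chi> g ^ j" using ij(3) unfolding tw_def hahn_twist_eq_iff by blast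
    also have "\<chi> g ^ j = \<chi> g ^ i * \<chi> g ^ (j - i)" using ij(1) by (simp flip: power_add)
    finally show "\<chi> g ^ (j - i) = 1" using \<chi>.char_nz[of g] by simp
  qed (use ij in auto)
qed

section \<open>The rational function field inside the Hahn field\<close>

lemma hmonom_1_power: "hmonom (1::'a::field) (1::rat) ^ n = hmonom 1 (of_nat n)"
proof (induction n)
  case 0
  show ?case by (rule hahn_eqI) (simp add: one_hahn.rep_eq hmonom.rep_eq)
next
  case (Suc n)
  then show ?case
    by (intro hahn_eqI) (auto simp: hcoeff_hmonom_mult hmonom.rep_eq algebra_simps)
qed

lemma hcoeff_sum: "hcoeff (\<Sum>i\<in>I. x i) g = (\<Sum>i\<in>I. hcoeff (x i) g)"
  by (induction I rule: infinite_finite_induct) (simp_all add: zero_hahn.rep_eq plus_hahn.rep_eq)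

lemma of_mod_ring_eq_0_iff:
  assumes "CHAR('a::field) = CARD('p::prime_card)"
  shows "(of_mod_ring (c :: 'p mod_ring) :: 'a) = 0 \<longleftrightarrow> c = 0"
proof -
  have r: "0 \<le> to_int_mod_ring c" "to_int_mod_ring c < int CARD('p)"
    using range_to_int_mod_ring[where ?'a = 'p] by (auto simp: set_eq_iff)
  have "(of_mod_ring c :: 'a) = 0 \<longleftrightarrow> int CARD('p) dvd to_int_mod_ring c"
    unfolding of_mod_ring_def of_int_eq_0_iff_char_dvd assms ..
  also have "\<dots> \<longleftrightarrow> to_int_mod_ring c = 0"
    using r zdvd_not_zless[of "to_int_mod_ring c" "int CARD('p)"] by (metis dvd_0_right order_le_less)
  also have "\<dots> \<longleftrightarrow> c = 0" by simp
  finally show ?thesis .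
qed

lemma hcoeff_hahn_of_poly:
  fixes q :: "'p::prime_card mod_ring poly"
  assumes "CHAR('a::field) = CARD('p)"
  shows "hcoeff (hahn_of_poly q :: ('a, rat) hahn) g =
    (\<Sum>i\<le>degree q. if g = of_nat i then of_mod_ring (coeff q i) else 0)"
proof -
  define h where "h c = (hmonom (of_mod_ring c) 0 :: ('a, rat) hahn)" for c :: "'p mod_ring"
  have h0: "h 0 = 0"
    using of_mod_ring_eq_0_iff[OF assms, of 0]
    by (intro hahn_eqI) (simp add: h_def hmonom.rep_eq zero_hahn.rep_eq)
  have deg: "degree (map_poly h q) \<le> degree q" by (rule degree_map_poly_le)
  have "hahn_of_poly q = (\<Sum>i\<le>degree q. h (coeff q i) * hmonom 1 1 ^ i)"
    unfolding hahn_of_poly_def h_def[symmetric] poly_altdef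
    using deg by (intro sum.mono_neutral_cong_left)
      (auto simp: coeff_map_poly h0 not_le coeff_eq_0[of "map_poly h q", unfolded coeff_map_poly[of h, OF h0]])
  then show ?thesis
    by (auto simp: hcoeff_sum h_def hmonom_1_power hcoeff_hmonom_mult hmonom.rep_eq intro!: sum.cong)
qed

lemma supp_hahn_of_poly:
  fixes q :: "'p::prime_card mod_ring poly"
  assumes "CHAR('a::field) = CARD('p)"
  shows "supp (hahn_of_poly q :: ('a, rat) hahn) \<subseteq> range of_nat"
proof
  fix g assume "g \<in> supp (hahn_of_poly q :: ('a, rat) hahn)"
  then have "(\<Sum>i\<le>degree q. if g = of_nat i then of_mod_ring (coeff q i) else 0 :: 'a) \<noteq> 0"
    by (simp add: supp_def hcoeff_hahn_of_poly[OF assms])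
  then obtain i where "(if g = of_nat i then of_mod_ring (coeff q i) else 0 :: 'a) \<noteq> 0"
    by (rule sum.not_neutral_contains_not_neutral)
  then show "g \<in> range of_nat" by (metis rangeI)
qed

lemma hahn_of_poly_eq_0_iff:
  fixes q :: "'p::prime_card mod_ring poly"
  assumes "CHAR('a::field) = CARD('p)"
  shows "(hahn_of_poly q :: ('a, rat) hahn) = 0 \<longleftrightarrow> q = 0"
proof
  assume "(hahn_of_poly q :: ('a, rat) hahn) = 0"
  then have "hcoeff (hahn_of_poly q :: ('a, rat) hahn) (of_nat (degree q)) = 0"
    by (simp add: zero_hahn.rep_eq)
  then have "(of_mod_ring (lead_coeff q) :: 'a) = 0"
    by (simp add: hcoeff_hahn_of_poly[OF assms])
  then show "q = 0" by (simp add: of_mod_ring_eq_0_iff[OF assms])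
qed (simp add: hahn_of_poly_def)

lemma hahn_of_ratfun_eq_0_iff:
  fixes r :: "'p::prime_card mod_ring poly fract"
  assumes "CHAR('a::field) = CARD('p)"
  shows "(hahn_of_ratfun r :: ('a, rat) hahn) = 0 \<longleftrightarrow> r = 0"
proof -
  have "r = Fract (fst (quot_of_fract r)) (snd (quot_of_fract r))"
    by (simp only: Fract_quot_of_fract)
  then have "fst (quot_of_fract r) = 0 \<longleftrightarrow> r = 0"
    by (metis fst_conv quot_of_fract_0 fract_collapse(1))
  then show ?thesis
    by (simp add: hahn_of_ratfun_def Let_def case_prod_unfold hahn_of_poly_eq_0_iff[OF assms])
qed

section \<open>Bounding the denominators\<close>

lemma supp_hahn_of_ratfun_subset_char_kernel:
  fixes r :: "'p::prime_card mod_ring poly fract" and \<chi> :: "rat \<Rightarrow> 'a::field alg_closure"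
  assumes "CHAR('a) = CARD('p)" "group_character \<chi>" "\<chi> 1 = 1"
  shows "supp (hahn_of_ratfun r :: ('a, rat) hahn) \<subseteq> {g. \<chi> g = 1}"
proof -
  interpret group_character \<chi> by fact
  have "\<chi> (of_nat n) = 1" for n
    by (induction n) (simp_all add: char_0 char_add assms(3))
  then have "supp (hahn_of_poly q :: ('a, rat) hahn) \<subseteq> {g. \<chi> g = 1}"
    for q :: "'p mod_ring poly"
    using supp_hahn_of_poly[OF assms(1), of q] by auto
  then show ?thesis
    unfolding hahn_of_ratfun_def Let_def case_prod_unfold
    using assms(2) by (intro supp_divide_subset_char_kernel)
qed

text \<open>
  With \<open>\<chi> (1 / b) = z\<close> of order \<open>q ^ Suc r\<close>, also \<open>\<chi> g\<close> has this order, since \<open>g = a / b\<close> and \<open>1 / b\<close>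
  generate the same group modulo the integers, on which \<open>\<chi>\<close> is trivial.
\<close>

lemma prime_power_dvd_denominator_le_degree:
  fixes f :: "'p::prime_card mod_ring poly fract poly" and x :: "('a::field, rat) hahn"
  assumes CH: "CHAR('a) = CARD('p)" and f: "f \<noteq> 0" "poly (map_poly hahn_of_ratfun f) x = 0"
    and g: "g \<in> supp x" "quotient_of g = (a, b)"
    and q: "prime q" "q \<noteq> CARD('p)" "int (q ^ Suc r) dvd b"
  shows "q ^ Suc r \<le> degree f"
proof -
  note rat0 = hahn_of_ratfun_eq_0_iff[OF CH]
  define P where "P = (map_poly hahn_of_ratfun f :: ('a, rat) hahn poly)"
  have coeffP: "coeff P i = hahn_of_ratfun (coeff f i)" for i
    unfolding P_def by (rule coeff_map_poly) (simp add: rat0)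
  have P: "P \<noteq> 0" "degree P \<le> degree f"
    using f(1) by (auto simp: poly_eq_iff coeffP rat0) (simp add: P_def degree_map_poly_le)
  have b: "b > 0" "coprime a b" "g = of_int a / of_int b"
    using g(2) by (auto dest: quotient_of_denom_pos quotient_of_coprime quotient_of_div)
  have "\<not> CARD('p) dvd q" using q(1,2) prime_card[where ?'a = 'p] by (metis primes_dvd_imp_eq)
  then have "(of_nat q :: 'a alg_closure) \<noteq> 0"
    by (simp add: of_nat_eq_0_iff_char_dvd CH)
  then obtain z :: "'a alg_closure" where z: "z ^ (q ^ Suc r) = 1" "z ^ (q ^ r) \<noteq> 1"
    using ex_prime_power_root_of_unity[OF q(1)] by metis
  from q(3) b(1) have "q ^ Suc r dvd nat b" by (simp add: int_dvd_int_iff[symmetric])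
  then obtain e where "nat b = q ^ Suc r * e" ..
  then have "z ^ nat b = 1" using z(1) by (simp only: power_mult power_one)
  then obtain \<chi> :: "rat \<Rightarrow> 'a alg_closure"
    where \<chi>: "group_character \<chi>" "\<chi> 1 = 1" "\<chi> (1 / of_nat (nat b)) = z"
    using ex_rat_character[of "nat b" z] b(1) by auto
  interpret group_character \<chi> by fact
  obtain k where k: "0 < k" "k \<le> degree P" "\<And>g. g \<in> supp x \<Longrightarrow> \<chi> g ^ k = 1"
    by (rule root_support_char_finite_order[OF \<chi>(1) P(1) _ f(2)[folded P_def]])
      (use coeffP supp_hahn_of_ratfun_subset_char_kernel[OF CH \<chi>(1,2)] in auto)
  note chi_int = char_of_int_mult[OF \<chi>(1)]
  \<comment> \<open>Modulo the integers, \<open>1 / b\<close> is a multiple of \<open>g\<close>, so the relation \<open>\<chi> g ^ k = 1\<close> passes to \<open>z\<close>.\<close>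
  obtain u v where uv: "u * a + v * b = 1" using b(2) by (metis coprime_iff_gcd_eq_1 bezout_int)
  have "1 / of_nat (nat b) = of_int u * g + of_int v * (1::rat)"
  proof -
    have "(of_int (u * a + v * b) :: rat) = 1" using uv by simp
    then show ?thesis using b(1) by (simp add: b(3) field_simps)
  qed
  then have "z = \<chi> g powi u"
    using \<chi>(2,3) chi_int[of u g] chi_int[of v 1] by (simp add: char_add)
  then have "z ^ k = (\<chi> g ^ k) powi u"
    by (metis power_int_of_nat power_int_mult mult.commute)
  then have "z ^ k = 1" using k(3)[OF g(1)] by simp
  then have "q ^ Suc r dvd k" using prime_power_dvd_exponent[OF q(1) z] by blast
  then show ?thesis using k P(2) by (meson dvd_imp_le order_trans)
qed

lemma dvd_power_fact_minus_1:
  fixes p :: nat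
  assumes "coprime p d" "0 < d" "d \<le> N"
  shows "d dvd p ^ fact N - 1"
proof (cases "p = 0")
  case False
  have "totient d > 0" "totient d \<le> N" using assms totient_le[of d] by auto
  then have "totient d dvd fact N" by (intro dvd_fact) linarith+
  then obtain e where e: "fact N = totient d * e" ..
  have "[(p ^ totient d) ^ e = 1 ^ e] (mod d)"
    using assms(1) by (intro cong_pow euler_theorem)
  then have "[p ^ fact N = 1] (mod d)" by (simp add: e power_mult)
  moreover have "1 \<le> p ^ fact N" using False by simp
  ultimately show ?thesis by (rule cong_altdef_nat[THEN iffD1, rotated])
qed (use assms in auto)

lemma root_hahn_supported_in_Gamma:
  fixes f :: "'p::prime_card mod_ring poly fract poly" and x :: "('a::field, rat) hahn"
  assumes CH: "CHAR('a) = CARD('p)" and f: "f \<noteq> 0" "poly (map_poly hahn_of_ratfun f) x = 0"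
    and N: "degree f \<le> N"
  shows "x \<in> hahn_supported_in (Gamma CARD('p) (CARD('p) ^ fact N - 1))"
  unfolding hahn_supported_in_def
proof (intro CollectI subsetI)
  define p where "p = CARD('p)"
  define m where "m = p ^ fact N - 1"
  have p: "prime p" unfolding p_def by (rule prime_card)
  have m: "m > 0" using one_less_power[OF prime_gt_1_nat[OF p], of "fact N"] by (simp add: m_def)
  fix g assume g: "g \<in> supp x"
  obtain a b where ab: "quotient_of g = (a, b)" by fastforce
  then have b: "b > 0" "g = of_int a / of_int b"
    by (auto dest: quotient_of_denom_pos quotient_of_div)
  define k where "k = multiplicity p (nat b)"
  have "nat b \<noteq> 0" "\<not> is_unit p" using b(1) prime_gt_1_nat[OF p] by simp_all
  then obtain d where d: "nat b = p ^ k * d" "\<not> p dvd d"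
    unfolding k_def by (rule multiplicity_decompose')
  have "d dvd m"
  proof (rule multiplicity_le_imp_dvd)
    show "d \<noteq> 0" using d(2) by (metis dvd_0_right)
    fix q :: nat assume q: "prime q"
    show "multiplicity q d \<le> multiplicity q m"
    proof (cases "multiplicity q d")
      case (Suc r)
      then have qd: "q ^ Suc r dvd d" by (metis multiplicity_dvd)
      then have "q \<noteq> p" using d(2) by (metis dvd_trans dvd_triv_left power_Suc)
      have "int (q ^ Suc r) dvd int (nat b)"
        using qd unfolding d(1) int_dvd_int_iff by (rule dvd_mult)
      then have qb: "int (q ^ Suc r) dvd b" using b(1) by simp
      have "q ^ Suc r \<le> N"
        using prime_power_dvd_denominator_le_degree[OF CH f g ab q \<open>q \<noteq> p\<close>[unfolded p_def] qb] N
        by (rule order_trans)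
      moreover have "coprime p (q ^ Suc r)"
        using primes_coprime[OF p q \<open>q \<noteq> p\<close>[symmetric]] by (simp only: coprime_power_right_iff simp_thms)
      ultimately have "q ^ Suc r dvd m"
        using prime_gt_0_nat[OF q] unfolding m_def by (intro dvd_power_fact_minus_1 zero_less_power)
      then show ?thesis
        unfolding Suc using m q by (intro multiplicity_geI) auto
    qed simp
  qed
  then obtain e where e: "m = d * e" ..
  then have "e > 0" "d > 0" using m by auto
  have "of_int b = (of_nat p ^ k * of_nat d :: rat)"
  proof -
    have "(of_int b :: rat) = of_nat (nat b)" using b(1) by simp
    then show ?thesis unfolding d(1) by simp
  qed
  then have "g = of_int (a * int e) / (of_nat m * of_nat p ^ k)"
    using \<open>e > 0\<close> \<open>d > 0\<close> by (simp add: b(2) e field_simps)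
  then show "g \<in> Gamma CARD('p) (CARD('p) ^ fact N - 1)"
    unfolding Gamma_def p_def[symmetric] m_def[symmetric] by blast
qed

section \<open>Computing the exponent bound\<close>

lemma length_le_list_encode: "length xs \<le> list_encode xs"
proof (induction xs)
  case (Cons x xs)
  then show ?case using le_prod_encode_2[of "list_encode xs" x] by simp
qed simp

fun const_rf :: "nat \<Rightarrow> recf" where
  "const_rf 0 = Zero"
| "const_rf (Suc n) = Comp Succ [const_rf n]"

text \<open>
  In the following primitive recursions, the step function gets the recursion counter as its
  argument 0 and the previous value as its argument 1.
\<close>

definition add_rf :: recf where
  "add_rf = PrimRec (Proj 0) (Comp Succ [Proj 1])"

definition mult_rf :: recf where
  "mult_rf = PrimRec Zero (Comp add_rf [Proj 1, Proj 2])"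

definition power_rf :: recf where
  "power_rf = PrimRec (const_rf 1) (Comp mult_rf [Proj 1, Proj 2])"

definition pred_rf :: recf where
  "pred_rf = PrimRec Zero (Proj 0)"

text \<open>
  By \<open>p ^ fact (Suc n) = (p ^ fact n) ^ Suc n\<close>, the recursion runs on the powers themselves and
  needs no factorial.
\<close>

definition power_fact_rf :: "nat \<Rightarrow> recf" where
  "power_fact_rf p = PrimRec (const_rf p) (Comp power_rf [Comp Succ [Proj 0], Proj 1])"

definition root_exponent_rf :: "nat \<Rightarrow> recf" where
  "root_exponent_rf p = Comp pred_rf [power_fact_rf p]"

lemma computes_Proj: "i < length xs \<Longrightarrow> y = xs ! i \<Longrightarrow> computes (Proj i) xs y"
  using computes.intros(3) by simp

lemma computes_Comp1: "computes g xs y \<Longrightarrow> computes f [y] z \<Longrightarrow> computes (Comp f [g]) xs z"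
  by (rule computes.intros(4)[of _ _ "[y]"]) auto

lemma computes_Comp2:
  "computes g xs y \<Longrightarrow> computes h xs y' \<Longrightarrow> computes f [y, y'] z \<Longrightarrow> computes (Comp f [g, h]) xs z"
  by (rule computes.intros(4)[of _ _ "[y, y']"]) auto

lemma computes_PrimRec:
  assumes "computes f xs (F 0)" "\<And>n. computes g (n # F n # xs) (F (Suc n))"
  shows "computes (PrimRec f g) (n # xs) (F n)"
  by (induction n) (use assms in \<open>auto intro: computes.intros(5,6)\<close>)

lemma computes_const_rf: "computes (const_rf n) xs n"
  by (induction n) (auto intro: computes.intros computes_Comp1)

lemma computes_add_rf: "computes add_rf [m, n] (m + n)"
  unfolding add_rf_def
  by (rule computes_PrimRec[where F = "\<lambda>m. m + n"])
    (auto intro!: computes_Proj computes_Comp1 intro: computes.intros(2))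

lemma computes_mult_rf: "computes mult_rf [m, n] (m * n)"
  unfolding mult_rf_def
  by (rule computes_PrimRec[where F = "\<lambda>m. m * n"])
    (auto intro!: computes.intros(1) computes_Comp2[OF computes_Proj computes_Proj]
      simp: add.commute[of n] computes_add_rf)

lemma computes_power_rf: "computes power_rf [n, b] (b ^ n)"
  unfolding power_rf_def
  by (rule computes_PrimRec[where F = "\<lambda>n. b ^ n"])
    (auto intro!: computes_const_rf computes_Comp2[OF computes_Proj computes_Proj]
      simp: mult.commute[of b] computes_mult_rf simp del: const_rf.simps One_nat_def)

lemma computes_pred_rf: "computes pred_rf [n] (n - 1)"
  unfolding pred_rf_def
  by (rule computes_PrimRec[where F = "\<lambda>n. n - 1"])
    (auto intro!: computes.intros(1) computes_Proj)

lemma computes_power_fact_rf: "computes (power_fact_rf p) [n] (p ^ fact n)"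
  unfolding power_fact_rf_def
proof (rule computes_PrimRec[where F = "\<lambda>n. p ^ fact n"])
  show "computes (const_rf p) [] (p ^ fact 0)" using computes_const_rf by simp
next
  fix n
  have "p ^ fact (Suc n) = (p ^ fact n) ^ Suc n"
    by (simp only: fact_Suc of_nat_id mult.commute[of "Suc n"] power_mult)
  then have "computes power_rf [Suc n, p ^ fact n] (p ^ fact (Suc n))"
    by (metis computes_power_rf)
  then show "computes (Comp power_rf [Comp Succ [Proj 0], Proj 1]) [n, p ^ fact n] (p ^ fact (Suc n))"
    by (rule computes_Comp2[rotated 2]) (auto intro!: computes_Comp1 computes_Proj computes.intros(2))
qed

lemma computes_root_exponent_rf: "computes (root_exponent_rf p) [n] (p ^ fact n - 1)"
  unfolding root_exponent_rf_def by (rule computes_Comp1[OF computes_power_fact_rf computes_pred_rf])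

theorem corollary5p4:
  fixes p :: nat
  assumes "CHAR('a::field) = p" and "p > 0" and "CARD('p::prime_card) = p"
  shows "\<exists>algo :: recf. \<forall>f :: 'p mod_ring poly fract poly. f \<noteq> 0 \<longrightarrow>
    (\<exists>m. computes algo [code_input f] m \<and> \<not> p dvd m \<and>
      (\<forall>x :: ('a, rat) hahn.
        poly (map_poly hahn_of_ratfun f) x = 0 \<longrightarrow> x \<in> hahn_supported_in (Gamma p m)))"
proof (intro exI[of _ "root_exponent_rf p"] allI impI)
  fix f :: "'p mod_ring poly fract poly"
  assume f: "f \<noteq> 0"
  define N where "N = code_input f"
  have "length (coeffs f) \<le> N"
    unfolding N_def code_input_def using length_le_list_encode by (metis length_map)
  then have N: "degree f \<le> N" using f by (simp add: length_coeffs)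
  have p: "prime p" using prime_card[where ?'a = 'p] assms(3) by simp
  have "\<not> p dvd p ^ fact N - 1"
  proof
    assume "p dvd p ^ fact N - 1"
    moreover have "p dvd p ^ fact N" by (simp add: dvd_power)
    moreover have "p ^ fact N - (p ^ fact N - 1) = 1" using assms(2) by simp
    ultimately have "p dvd 1" by (metis dvd_diff_nat)
    then show False using p by simp
  qed
  moreover have "x \<in> hahn_supported_in (Gamma p (p ^ fact N - 1))"
    if "poly (map_poly hahn_of_ratfun f) x = 0" for x :: "('a, rat) hahn"
    using root_hahn_supported_in_Gamma[OF _ f that N] assms by simp
  ultimately show "\<exists>m. computes (root_exponent_rf p) [code_input f] m \<and> \<not> p dvd m \<and>
      (\<forall>x :: ('a, rat) hahn.
        poly (map_poly hahn_of_ratfun f) x = 0 \<longrightarrow> x \<in> hahn_supported_in (Gamma p m))"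
    using computes_root_exponent_rf[of p N] unfolding N_def by blast
qed

end
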